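(* Let $G$ be a graph and let $\overline{G}$ be its complement. If $I_c(G)$ is normal, then $\overline{G}$ has no Hochster configuration with induced odd cycles $C_1$, $C_2$ of length at least $5$.
   Context: Graphs are finite, with no multiple edges or loops. The vertices of $G$, $V(G)=\{t_1,\ldots,t_s\}$, are regarded as variables of the polynomial ring $S=K[t_1,\ldots,t_s]$ over a field $K$. The complement $\overline{G}$ has the same vertex set as $G$, and two distinct vertices are adjacent in $\overline{G}$ if and only if they are not adjacent in $G$. A vertex cover is a set of vertices meeting every edge; the ideal of covers $I_c(G)$ is the ideal of $S$ generated by all $\prod_{t_i\in C}t_i$ with $C$ an inclusion-minimal vertex cover of $G$ ($I_c(G)=S$ if $G$ has no edges). An ideal $J$ is normal if $J^n=\overline{J^n}$ for all $n\geq 1$, where $\overline{J^n}$ is the integral closure of $J^n$. A Hochster configuration of a graph $H$ consists of two odd cycles $C_1,C_2$ of $H$ such that (i) $C_1\cap N_H(C_2)=\emptyset$, where $N_H(C_2)$ is the set of vertices of $H$ adjacent to some vertex of $C_2$; and (ii) no chord of $C_i$, $i=1,2$, is an edge of $H$, i.e., each $C_i$ is an induced cycle of $H$. *)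

theory Defs
  imports Complex_Main "HOL-Library.Poly_Mapping"
begin

text \<open>
  A graph has a finite type of vertices and is given by its adjacency relation.
  The polynomial ring over the field \<open>'k\<close> in the vertices as variables is
  \<open>('v \<Rightarrow>\<^sub>0 nat) \<Rightarrow>\<^sub>0 'k\<close>: finitely supported coefficient functions on exponent vectors,
  with the convolution product.
\<close>

type_synonym ('v, 'k) mpoly = "('v \<Rightarrow>\<^sub>0 nat) \<Rightarrow>\<^sub>0 'k"

definition variable :: "'v \<Rightarrow> ('v, 'k::comm_ring_1) mpoly" where
  "variable v = Poly_Mapping.single (Poly_Mapping.single v 1) 1"


subsection \<open>Ideals\<close>

text \<open>Ideals are the submodules of the ring as a module over itself.\<close>

definition ideal_generated :: "'a::comm_ring_1 set \<Rightarrow> 'a set" where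
  "ideal_generated B = module.span (*) B"

primrec ideal_power :: "'a::comm_ring_1 set \<Rightarrow> nat \<Rightarrow> 'a set" where
  "ideal_power J 0 = UNIV"
| "ideal_power J (Suc n) = ideal_generated {a * b | a b. a \<in> J \<and> b \<in> ideal_power J n}"

definition integral_closure :: "'a::comm_ring_1 set \<Rightarrow> 'a set" where
  "integral_closure J =
     {z. \<exists>m\<ge>1. \<exists>a. (\<forall>i\<in>{1..m}. a i \<in> ideal_power J i) \<and>
           z ^ m + (\<Sum>i=1..m. a i * z ^ (m - i)) = 0}"

definition normal_ideal :: "'a::comm_ring_1 set \<Rightarrow> bool" where
  "normal_ideal J \<longleftrightarrow> (\<forall>n\<ge>1. ideal_power J n = integral_closure (ideal_power J n))"


subsection \<open>Graphs and ideals of covers\<close>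

definition simple_graph :: "('v \<Rightarrow> 'v \<Rightarrow> bool) \<Rightarrow> bool" where
  "simple_graph G \<longleftrightarrow> symp G \<and> irreflp G"

definition graph_complement :: "('v \<Rightarrow> 'v \<Rightarrow> bool) \<Rightarrow> 'v \<Rightarrow> 'v \<Rightarrow> bool" where
  "graph_complement G u v \<longleftrightarrow> u \<noteq> v \<and> \<not> G u v"

definition vertex_cover :: "('v \<Rightarrow> 'v \<Rightarrow> bool) \<Rightarrow> 'v set \<Rightarrow> bool" where
  "vertex_cover G C \<longleftrightarrow> (\<forall>u v. G u v \<longrightarrow> u \<in> C \<or> v \<in> C)"

definition minimal_vertex_cover :: "('v \<Rightarrow> 'v \<Rightarrow> bool) \<Rightarrow> 'v set \<Rightarrow> bool" where
  "minimal_vertex_cover G C \<longleftrightarrow> vertex_cover G C \<and> (\<forall>D. D \<subset> C \<longrightarrow> \<not> vertex_cover G D)"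

text \<open>
  For an edgeless graph the only minimal vertex cover is the empty set, so the ideal below is
  generated by the empty product 1 and is the whole ring.
\<close>

definition cover_ideal :: "('v::finite \<Rightarrow> 'v \<Rightarrow> bool) \<Rightarrow> ('v, 'k::field) mpoly set" where
  "cover_ideal G = ideal_generated {(\<Prod>v\<in>C. variable v) | C. minimal_vertex_cover G C}"


subsection \<open>Cycles and Hochster configurations\<close>

text \<open>A cycle is the list of its vertices in cyclic order, without repeating the first one.\<close>

definition cycle :: "('v \<Rightarrow> 'v \<Rightarrow> bool) \<Rightarrow> 'v list \<Rightarrow> bool" where
  "cycle H c \<longleftrightarrow> length c \<ge> 3 \<and> distinct c \<and>
     (\<forall>i<length c. H (c ! i) (c ! (Suc i mod length c)))"

definition chordless :: "('v \<Rightarrow> 'v \<Rightarrow> bool) \<Rightarrow> 'v list \<Rightarrow> bool" where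
  "chordless H c \<longleftrightarrow>
     (\<forall>i<length c. \<forall>j<length c. H (c ! i) (c ! j) \<longrightarrow>
        j = Suc i mod length c \<or> i = Suc j mod length c)"

definition neighbours :: "('v \<Rightarrow> 'v \<Rightarrow> bool) \<Rightarrow> 'v set \<Rightarrow> 'v set" where
  "neighbours H A = {v. \<exists>u\<in>A. H u v}"

definition hochster_configuration ::
    "('v \<Rightarrow> 'v \<Rightarrow> bool) \<Rightarrow> 'v list \<Rightarrow> 'v list \<Rightarrow> bool" where
  "hochster_configuration H c\<^sub>1 c\<^sub>2 \<longleftrightarrow>
     cycle H c\<^sub>1 \<and> odd (length c\<^sub>1) \<and> cycle H c\<^sub>2 \<and> odd (length c\<^sub>2) \<and>
     set c\<^sub>1 \<inter> neighbours H (set c\<^sub>2) = {} \<and>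
     chordless H c\<^sub>1 \<and> chordless H c\<^sub>2"

end

theory Submission
  imports Defs
begin

text \<open>
  Let \<open>H\<close> be the complement of \<open>G\<close>. The vertex covers of \<open>G\<close> are the complements of the
  cliques of \<open>H\<close>, so a monomial with exponent vector \<open>m\<close> lies in the \<open>n\<close>-th power of the ideal
  of covers exactly if there are \<open>n\<close> cliques of \<open>H\<close> such that each vertex \<open>v\<close> lies in at least
  \<open>n - m v\<close> of them. Suppose that \<open>H\<close> has a Hochster configuration formed by cycles of lengths
  \<open>2k + 1\<close> and \<open>2l + 1\<close>, both at least 5, put \<open>n = k + l + 1\<close>, and let \<open>z\<close> be the monomial with
  exponent \<open>n - 1\<close> at the vertices on the two cycles and \<open>n\<close> at all other vertices.

  The \<open>2n\<close> edges of the two cycles cover each vertex of the cycles twice. Since an edge is a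
  clique, this exhibits \<open>z\<^sup>2\<close> as a multiple of a product of \<open>2n\<close> generators, hence as an
  element of the square of the \<open>n\<close>-th power, and \<open>z\<close> is integral over the \<open>n\<close>-th power.

  If \<open>z\<close> were in the \<open>n\<close>-th power itself, then \<open>n\<close> cliques would cover all vertices of the two
  cycles. A clique meets only one of the two cycles, because no edge of \<open>H\<close> joins them, and it
  contains at most two vertices of it, because a chordless cycle of length at least 4 contains no
  triangle. Covering an odd cycle of length \<open>2k + 1\<close> in this way takes \<open>k + 1\<close> cliques, so both
  cycles together take \<open>(k + 1) + (l + 1) > n\<close> cliques, a contradiction. The half-integral
  cover by edges beats every integral one by a half on each of the two odd cycles, and the two
  halves add up to a whole clique.

  The integral bound is \<open>keys_ideal_power\<close> applied to the exponent sets
  \<open>cycle_exponents\<close>; integrality of \<open>z\<close> is \<open>integral_if_power_mem\<close>.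
\<close>


section \<open>Powers of ideals\<close>

interpretation ring_module: module "(*) :: 'a::comm_ring_1 \<Rightarrow> 'a \<Rightarrow> 'a"
  by unfold_locales (auto simp: algebra_simps)

lemma ideal_generated_base: "b \<in> B \<Longrightarrow> b \<in> ideal_generated B"
  unfolding ideal_generated_def by (rule ring_module.span_base)

lemma ideal_generated_mult: "b \<in> ideal_generated B \<Longrightarrow> r * b \<in> ideal_generated B"
  unfolding ideal_generated_def by (rule ring_module.span_scale)

lemma zero_mem_ideal_power: "0 \<in> ideal_power J n"
  by (cases n) (auto simp: ideal_generated_def ring_module.span_zero)

lemma ideal_power_mult: "b \<in> ideal_power J n \<Longrightarrow> r * b \<in> ideal_power J n"
  by (cases n) (auto intro: ideal_generated_mult)

lemma mult_mem_ideal_power_Suc: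
  "a \<in> J \<Longrightarrow> b \<in> ideal_power J n \<Longrightarrow> a * b \<in> ideal_power J (Suc n)"
  by (auto intro!: ideal_generated_base)

lemma prod_mem_ideal_power:
  assumes "\<And>i. i < n \<Longrightarrow> f i \<in> J"
  shows "(\<Prod>i<n. f i) \<in> ideal_power J n"
  using assms
proof (induction n)
  case (Suc n)
  then have "f n * (\<Prod>i<n. f i) \<in> ideal_power J (Suc n)"
    by (intro mult_mem_ideal_power_Suc) auto
  then show ?case by (simp add: mult.commute)
qed simp

lemma prod_lessThan_add:
  fixes f :: "nat \<Rightarrow> 'a::comm_monoid_mult"
  shows "(\<Prod>i<m + n. f i) = (\<Prod>i<m. f i) * (\<Prod>i<n. f (m + i))"
  by (induction n) (simp_all add: ac_simps)

lemma mult_mem_ideal_power_2: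
  assumes "a \<in> J" "b \<in> J"
  shows "a * b \<in> ideal_power J 2"
proof -
  have "b * 1 \<in> ideal_power J (Suc 0)"
    using assms(2) by (intro mult_mem_ideal_power_Suc) auto
  then show ?thesis
    using mult_mem_ideal_power_Suc[OF assms(1), of "b * 1" "Suc 0"] by (simp add: numeral_2_eq_2)
qed

text \<open>The equation of integral dependence is \<open>X\<^sup>m - z\<^sup>m = 0\<close>.\<close>

lemma integral_if_power_mem:
  assumes "m \<ge> 1" "z ^ m \<in> ideal_power J m"
  shows "z \<in> integral_closure J"
proof -
  define a where "a i = (if i = m then - (z ^ m) else 0)" for i
  have "- 1 * z ^ m \<in> ideal_power J m"
    using assms(2) by (rule ideal_power_mult)
  then have "\<forall>i\<in>{1..m}. a i \<in> ideal_power J i"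
    by (auto simp: a_def zero_mem_ideal_power)
  moreover have "(\<Sum>i=1..m. a i * z ^ (m - i)) = (\<Sum>i=1..m. if i = m then - (z ^ m) else 0)"
    by (rule sum.cong) (auto simp: a_def)
  then have "z ^ m + (\<Sum>i=1..m. a i * z ^ (m - i)) = 0"
    using assms(1) by (simp add: sum.delta)
  ultimately show ?thesis
    unfolding integral_closure_def using assms(1) by blast
qed


section \<open>Monomials of the elements of an ideal\<close>

text \<open>
  The polynomials whose monomials all lie in \<open>A\<close> form an ideal as soon as \<open>A\<close> is closed under
  multiplication of its monomials by arbitrary monomials.
\<close>

lemma keys_ideal_generated:
  fixes B :: "('v, 'k::comm_ring_1) mpoly set"
  assumes up: "\<And>m d. m \<in> A \<Longrightarrow> d + m \<in> A"
    and gen: "\<And>b. b \<in> B \<Longrightarrow> Poly_Mapping.keys b \<subseteq> A"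
    and "f \<in> ideal_generated B"
  shows "Poly_Mapping.keys f \<subseteq> A"
proof -
  have "Poly_Mapping.keys (r * g) \<subseteq> A" if "Poly_Mapping.keys g \<subseteq> A" for r g :: "('v, 'k) mpoly"
    using keys_mult[of r g] up that by blast
  then have "ring_module.subspace {g :: ('v, 'k) mpoly. Poly_Mapping.keys g \<subseteq> A}"
    by (auto intro!: ring_module.subspaceI dest!: subsetD[OF Poly_Mapping.keys_add])
  then have "module.span (*) B \<subseteq> {g. Poly_Mapping.keys g \<subseteq> A}"
    by (intro ring_module.span_minimal) (auto dest: gen)
  then show ?thesis
    using assms(3) by (auto simp: ideal_generated_def)
qed

text \<open>
  A family \<open>A n\<close> of exponent sets that behaves additively in \<open>n\<close> therefore bounds the powers of an
  ideal once it bounds the ideal. Additivity with \<open>A 0 = UNIV\<close> contains the closure under arbitrary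
  monomials.
\<close>

lemma keys_ideal_power:
  fixes B :: "('v, 'k::comm_ring_1) mpoly set"
  assumes zero: "A 0 = UNIV"
    and add: "\<And>i j m m'. m \<in> A i \<Longrightarrow> m' \<in> A j \<Longrightarrow> m + m' \<in> A (i + j)"
    and gen: "\<And>b. b \<in> B \<Longrightarrow> Poly_Mapping.keys b \<subseteq> A 1"
    and "f \<in> ideal_power (ideal_generated B) n"
  shows "Poly_Mapping.keys f \<subseteq> A n"
  using assms(4)
proof (induction n arbitrary: f)
  case 0
  then show ?case by (simp add: zero)
next
  case (Suc n)
  have up: "d + m \<in> A i" if "m \<in> A i" for d m i
    using add[of d 0 m i] that zero by simp
  have gens: "Poly_Mapping.keys g \<subseteq> A 1" if "g \<in> ideal_generated B" for g
    using keys_ideal_generated[of "A 1" B g] up gen that by blast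
  have "Poly_Mapping.keys (a * b) \<subseteq> A (Suc n)"
    if "a \<in> ideal_generated B" "b \<in> ideal_power (ideal_generated B) n" for a b
    using keys_mult[of a b] gens[OF that(1)] Suc.IH[OF that(2)] add[of _ 1 _ n] by fastforce
  then show ?case
    using Suc.prems unfolding ideal_power.simps
    by (intro keys_ideal_generated[of "A (Suc n)" _ f] up) auto
qed

definition squarefree_exponent :: "'v set \<Rightarrow> 'v \<Rightarrow>\<^sub>0 nat" where
  "squarefree_exponent C = (\<Sum>v\<in>C. Poly_Mapping.single v 1)"

lemma lookup_squarefree_exponent:
  fixes C :: "'v::finite set"
  shows "Poly_Mapping.lookup (squarefree_exponent C) v = of_bool (v \<in> C)"
proof -
  have "Poly_Mapping.lookup (squarefree_exponent C) v = (\<Sum>u\<in>C. if v = u then 1 else 0)"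
    by (simp add: squarefree_exponent_def lookup_sum lookup_single when_def eq_commute)
  then show ?thesis
    by (simp add: sum.delta)
qed

lemma prod_single_1:
  "(\<Prod>i\<in>I. Poly_Mapping.single (m i) (1::'k::comm_ring_1)) = Poly_Mapping.single (\<Sum>i\<in>I. m i) 1"
  by (induction I rule: infinite_finite_induct) (auto simp: mult_single single_one)

lemma prod_variable:
  "(\<Prod>v\<in>C. variable v :: ('v, 'k::comm_ring_1) mpoly)
     = Poly_Mapping.single (squarefree_exponent C) 1"
  unfolding variable_def squarefree_exponent_def by (rule prod_single_1)


section \<open>Cliques of the complement\<close>

lemma finite_vertex_cover_contains_minimal:
  fixes G :: "'v::finite \<Rightarrow> 'v \<Rightarrow> bool"
  assumes "vertex_cover G C"
  obtains D where "D \<subseteq> C" "minimal_vertex_cover G D"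
proof -
  have "finite {D. vertex_cover G D}" by simp
  from finite_has_minimal2[OF this, of C] assms
  obtain D where "vertex_cover G D" "D \<subseteq> C"
    and "\<And>E. vertex_cover G E \<Longrightarrow> E \<subseteq> D \<Longrightarrow> D = E"
    by auto
  then show ?thesis
    using that[of D] unfolding minimal_vertex_cover_def by blast
qed

lemma minimal_vertex_cover_avoiding_complement_edge:
  fixes G :: "'v::finite \<Rightarrow> 'v \<Rightarrow> bool"
  assumes "simple_graph G" "graph_complement G u v"
  obtains D where "minimal_vertex_cover G D" "u \<notin> D" "v \<notin> D"
proof -
  have "vertex_cover G (- {u, v})"
    using assms unfolding vertex_cover_def simple_graph_def graph_complement_def
    by (auto dest: sympD irreflpD)
  then show ?thesis
    using that by (elim finite_vertex_cover_contains_minimal) auto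
qed

lemma vertex_cover_complement_clique:
  "vertex_cover G D \<Longrightarrow> u \<notin> D \<Longrightarrow> v \<notin> D \<Longrightarrow> u \<noteq> v \<Longrightarrow> graph_complement G u v"
  unfolding vertex_cover_def graph_complement_def by blast

text \<open>
  Three vertices of a clique would be pairwise consecutive on the cycle, which forces length 3.
\<close>

lemma clique_on_chordless_cycle:
  assumes "chordless H c" "length c \<ge> 4" "K \<subseteq> set c"
    and clique: "\<And>u v. u \<in> K \<Longrightarrow> v \<in> K \<Longrightarrow> u \<noteq> v \<Longrightarrow> H u v"
  shows "card K \<le> 2"
proof (rule ccontr)
  assume "\<not> card K \<le> 2"
  then obtain T where "T \<subseteq> K" "card T = 3"
    using obtain_subset_with_card_n[of 3 K] by auto
  then obtain x y z where xyz: "x \<in> K" "y \<in> K" "z \<in> K" "x \<noteq> y" "y \<noteq> z" "x \<noteq> z"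
    by (auto simp: card_3_iff)
  then obtain i j k where ijk: "i < length c" "j < length c" "k < length c"
    and eqs: "x = c ! i" "y = c ! j" "z = c ! k"
    using assms(3) by (metis in_set_conv_nth subsetD)
  have ne: "i \<noteq> j" "j \<noteq> k" "i \<noteq> k" using xyz eqs by auto
  have step: "Suc p mod length c = (if Suc p = length c then 0 else Suc p)"
    if "p < length c" for p
    using that by auto
  have "j = Suc i mod length c \<or> i = Suc j mod length c"
    "k = Suc j mod length c \<or> j = Suc k mod length c"
    "k = Suc i mod length c \<or> i = Suc k mod length c"
    using assms(1) clique xyz eqs ijk unfolding chordless_def by metis+
  then show False
    using ne ijk assms(2) unfolding step[OF ijk(1)] step[OF ijk(2)] step[OF ijk(3)]
    by (auto split: if_splits)
qed


section \<open>Covering two cycles by cliques\<close>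

text \<open>
  These are the exponent vectors compatible with a choice of \<open>n\<close> cliques, \<open>n\<^sub>1\<close> of which take at
  most two vertices from \<open>X\<close> and none from \<open>Y\<close>, and \<open>n\<^sub>2\<close> the other way round; the conditions
  count incidences. The separate natural numbers \<open>n\<^sub>1\<close> and \<open>n\<^sub>2\<close> are what makes the sets detect
  that the two cycles are odd: each of the bounds can be rounded up by itself, whereas their sum
  only involves the even number \<open>card X + card Y\<close>.
\<close>

definition cycle_exponents :: "'v set \<Rightarrow> 'v set \<Rightarrow> nat \<Rightarrow> ('v \<Rightarrow>\<^sub>0 nat) set" where
  "cycle_exponents X Y n = {m. \<exists>n\<^sub>1 n\<^sub>2. n\<^sub>1 + n\<^sub>2 = n \<and>
      n * card X \<le> sum (Poly_Mapping.lookup m) X + 2 * n\<^sub>1 \<and>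
      n * card Y \<le> sum (Poly_Mapping.lookup m) Y + 2 * n\<^sub>2}"

lemma cycle_exponents_0: "cycle_exponents X Y 0 = UNIV"
  by (auto simp: cycle_exponents_def)

lemma cycle_exponents_commute: "cycle_exponents X Y n = cycle_exponents Y X n"
proof -
  have "cycle_exponents X Y n \<subseteq> cycle_exponents Y X n" for X Y :: "'v set"
    unfolding cycle_exponents_def by (force simp: add.commute)
  then show ?thesis by blast
qed

lemma cycle_exponents_add:
  assumes "m \<in> cycle_exponents X Y i" "m' \<in> cycle_exponents X Y j"
  shows "m + m' \<in> cycle_exponents X Y (i + j)"
proof -
  from assms obtain n\<^sub>1 n\<^sub>2 n\<^sub>1' n\<^sub>2' where
    "n\<^sub>1 + n\<^sub>2 = i"
    "i * card X \<le> sum (Poly_Mapping.lookup m) X + 2 * n\<^sub>1"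
    "i * card Y \<le> sum (Poly_Mapping.lookup m) Y + 2 * n\<^sub>2"
    "n\<^sub>1' + n\<^sub>2' = j"
    "j * card X \<le> sum (Poly_Mapping.lookup m') X + 2 * n\<^sub>1'"
    "j * card Y \<le> sum (Poly_Mapping.lookup m') Y + 2 * n\<^sub>2'"
    unfolding cycle_exponents_def by blast
  then show ?thesis
    unfolding cycle_exponents_def
    by (intro CollectI exI[of _ "n\<^sub>1 + n\<^sub>1'"] exI[of _ "n\<^sub>2 + n\<^sub>2'"])
       (auto simp: lookup_add sum.distrib algebra_simps)
qed

lemma squarefree_exponent_in_cycle_exponents:
  fixes X Y :: "'v::finite set"
  assumes "card (X - D) \<le> 2" "Y \<subseteq> D"
  shows "squarefree_exponent D \<in> cycle_exponents X Y 1"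
proof -
  have "sum (Poly_Mapping.lookup (squarefree_exponent D)) Z = card (Z \<inter> D)" for Z :: "'v set"
    by (simp add: lookup_squarefree_exponent Int_def)
  moreover have "card X = card (X \<inter> D) + card (X - D)"
    by (metis card_Diff_subset_Int finite card_mono inf_le1 le_add_diff_inverse)
  moreover have "Y \<inter> D = Y" using assms(2) by blast
  ultimately show ?thesis
    unfolding cycle_exponents_def using assms(1)
    by (intro CollectI exI[of _ 1] exI[of _ 0]) auto
qed

lemma vertex_cover_in_cycle_exponents:
  fixes G :: "'v::finite \<Rightarrow> 'v \<Rightarrow> bool"
  assumes "vertex_cover G D"
    and "chordless (graph_complement G) c" "length c \<ge> 4"
    and "chordless (graph_complement G) d" "length d \<ge> 4"
    and separated: "\<And>u v. u \<in> set d \<Longrightarrow> v \<in> set c \<Longrightarrow> u \<noteq> v \<and> \<not> graph_complement G u v"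
  shows "squarefree_exponent D \<in> cycle_exponents (set c) (set d) 1"
proof -
  have "card (set c - D) \<le> 2"
    using assms(2,3) by (rule clique_on_chordless_cycle)
      (auto intro: vertex_cover_complement_clique[OF assms(1)])
  moreover have "card (set d - D) \<le> 2"
    using assms(4,5) by (rule clique_on_chordless_cycle)
      (auto intro: vertex_cover_complement_clique[OF assms(1)])
  moreover have "set c \<subseteq> D \<or> set d \<subseteq> D"
    using separated vertex_cover_complement_clique[OF assms(1)] by blast
  ultimately show ?thesis
    using squarefree_exponent_in_cycle_exponents[of "set c" D "set d"]
      squarefree_exponent_in_cycle_exponents[of "set d" D "set c"]
    by (auto simp: cycle_exponents_commute)
qed


section \<open>Edges of a cycle\<close>

text \<open>
  Each vertex of a cycle lies on the edge that leaves it and on the one that enters it.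
\<close>

lemma two_cycle_edges_at_vertex:
  assumes "cycle H c" "v \<in> set c"
  obtains i j where "i < length c" "j < length c" "i \<noteq> j"
    "v = c ! i" "v = c ! (Suc j mod length c)"
proof -
  obtain i where i: "i < length c" "v = c ! i"
    using assms(2) by (auto simp: in_set_conv_nth)
  have len: "length c \<ge> 3" using assms(1) by (simp add: cycle_def)
  define j where "j = (if i = 0 then length c - 1 else i - 1)"
  have "Suc j mod length c = i" "j < length c" "j \<noteq> i"
    using i len by (auto simp: j_def)
  then show ?thesis using that i by metis
qed

lemma card_missing_two:
  fixes D :: "nat \<Rightarrow> 'v set"
  assumes "i < n" "j < n" "i \<noteq> j" "v \<notin> D i" "v \<notin> D j"
  shows "(\<Sum>k<n. of_bool (v \<in> D k)) \<le> n - 2"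
proof -
  have "(\<Sum>k<n. of_bool (v \<in> D k)) = card {k\<in>{..<n}. v \<in> D k}"
    by (simp add: Int_def)
  also have "\<dots> \<le> card ({..<n} - {i, j})"
    using assms by (intro card_mono) auto
  also have "\<dots> = n - 2"
    using assms by (subst card_Diff_subset) auto
  finally show ?thesis .
qed

theorem corollary5p10:
  fixes G :: "'v::finite \<Rightarrow> 'v \<Rightarrow> bool"
  assumes "simple_graph G"
    and "normal_ideal (cover_ideal G :: ('v, 'k::field) mpoly set)"
  shows "\<not> (\<exists>c\<^sub>1 c\<^sub>2. hochster_configuration (graph_complement G) c\<^sub>1 c\<^sub>2 \<and>
                length c\<^sub>1 \<ge> 5 \<and> length c\<^sub>2 \<ge> 5)"
proof
  let ?H = "graph_complement G"
  let ?I = "cover_ideal G :: ('v, 'k) mpoly set"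
  assume "\<exists>c\<^sub>1 c\<^sub>2. hochster_configuration ?H c\<^sub>1 c\<^sub>2 \<and> length c\<^sub>1 \<ge> 5 \<and> length c\<^sub>2 \<ge> 5"
  then obtain c d where cyc: "cycle ?H c" "cycle ?H d"
    and odd: "odd (length c)" "odd (length d)"
    and nb: "set c \<inter> neighbours ?H (set d) = {}"
    and chordless: "chordless ?H c" "chordless ?H d"
    and len: "length c \<ge> 5" "length d \<ge> 5"
    unfolding hochster_configuration_def by blast

  have no_edge: "\<not> ?H u v" if "u \<in> set d" "v \<in> set c" for u v
    using nb that by (auto simp: neighbours_def)
  \<comment> \<open>A common vertex would be adjacent to its predecessor on the second cycle, hence a neighbour of that cycle.\<close>
  have separated: "u \<noteq> v \<and> \<not> ?H u v" if uv: "u \<in> set d" "v \<in> set c" for u v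
  proof -
    obtain j where "j < length d" "u = d ! (Suc j mod length d)"
      using two_cycle_edges_at_vertex[OF cyc(2) uv(1)] by metis
    then have "?H (d ! j) u" "d ! j \<in> set d"
      using cyc(2) by (auto simp: cycle_def)
    then show ?thesis using no_edge uv by blast
  qed

  obtain k l where kl: "length c = 2 * k + 1" "length d = 2 * l + 1"
    using odd by (auto elim!: oddE)
  define n where "n = k + l + 1"
  have n2: "2 * n = length c + length d" and n1: "n \<ge> 1" using kl by (auto simp: n_def)
  define \<alpha> where "\<alpha> = (\<Sum>v\<in>UNIV. Poly_Mapping.single v (if v \<in> set c \<union> set d then n - 1 else n))"
  have lookup_\<alpha>: "Poly_Mapping.lookup \<alpha> v = (if v \<in> set c \<union> set d then n - 1 else n)" for v
    by (simp add: \<alpha>_def lookup_sum lookup_single when_def sum.delta')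
  define z where "z = (Poly_Mapping.single \<alpha> 1 :: ('v, 'k) mpoly)"

  have "\<alpha> \<notin> cycle_exponents (set c) (set d) n"
  proof
    assume "\<alpha> \<in> cycle_exponents (set c) (set d) n"
    then obtain n\<^sub>1 n\<^sub>2 where split: "n\<^sub>1 + n\<^sub>2 = n"
      and "n * card (set c) \<le> sum (Poly_Mapping.lookup \<alpha>) (set c) + 2 * n\<^sub>1"
      and "n * card (set d) \<le> sum (Poly_Mapping.lookup \<alpha>) (set d) + 2 * n\<^sub>2"
      unfolding cycle_exponents_def by blast
    moreover have "card (set c) = length c" "card (set d) = length d"
      using cyc by (auto simp: cycle_def distinct_card)
    moreover have "sum (Poly_Mapping.lookup \<alpha>) (set c) = (n - 1) * card (set c)"
      "sum (Poly_Mapping.lookup \<alpha>) (set d) = (n - 1) * card (set d)"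
      by (simp_all add: lookup_\<alpha>)
    moreover have "n * p = (n - 1) * p + p" for p
      using n1 by (cases n) auto
    ultimately have "length c \<le> 2 * n\<^sub>1" "length d \<le> 2 * n\<^sub>2"
      by (metis nat_add_left_cancel_le)+
    then have "n\<^sub>1 \<ge> k + 1" "n\<^sub>2 \<ge> l + 1" using kl by auto
    then show False using split by (simp add: n_def)
  qed
  moreover have "Poly_Mapping.keys f \<subseteq> cycle_exponents (set c) (set d) n"
    if f: "f \<in> ideal_power ?I n" for f
  proof (rule keys_ideal_power[where A = "cycle_exponents (set c) (set d)"])
    show "f \<in> ideal_power
        (ideal_generated {(\<Prod>v\<in>C. variable v) |C. minimal_vertex_cover G C}) n"
      using f by (simp add: cover_ideal_def)
  next
    fix b :: "('v, 'k) mpoly"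
    assume "b \<in> {(\<Prod>v\<in>C. variable v) |C. minimal_vertex_cover G C}"
    then obtain D where "vertex_cover G D" "b = Poly_Mapping.single (squarefree_exponent D) 1"
      by (auto simp: prod_variable minimal_vertex_cover_def)
    then show "Poly_Mapping.keys b \<subseteq> cycle_exponents (set c) (set d) 1"
      using vertex_cover_in_cycle_exponents[of G D c d] chordless len separated by auto
  qed (simp_all only: cycle_exponents_0 cycle_exponents_add)
  ultimately have z_notin: "z \<notin> ideal_power ?I n"
    unfolding z_def by fastforce

  \<comment> \<open>All edges of both cycles in one list, so that its first and second half of length \<open>n\<close>
    give two elements of the \<open>n\<close>-th power; the cut need not fall between the cycles.\<close>
  define edge where "edge i = (if i < length c then (c ! i, c ! (Suc i mod length c))
    else (d ! (i - length c), d ! (Suc (i - length c) mod length d)))" for i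
  have "\<exists>D. minimal_vertex_cover G D \<and> fst (edge i) \<notin> D \<and> snd (edge i) \<notin> D"
    if "i < 2 * n" for i
  proof -
    have "?H (fst (edge i)) (snd (edge i))"
      using that cyc n2 by (auto simp: edge_def cycle_def)
    then show ?thesis
      using minimal_vertex_cover_avoiding_complement_edge[OF assms(1)] by metis
  qed
  then obtain D where D: "\<And>i. i < 2 * n \<Longrightarrow> minimal_vertex_cover G (D i)"
    and avoid: "\<And>i. i < 2 * n \<Longrightarrow> fst (edge i) \<notin> D i \<and> snd (edge i) \<notin> D i"
    by metis
  define \<beta> where "\<beta> = (\<Sum>i<2 * n. squarefree_exponent (D i))"
  have lookup_\<beta>: "Poly_Mapping.lookup \<beta> v = (\<Sum>i<2 * n. of_bool (v \<in> D i))" for v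
    by (simp add: \<beta>_def lookup_sum lookup_squarefree_exponent)
  have le: "Poly_Mapping.lookup \<beta> v \<le> Poly_Mapping.lookup (\<alpha> + \<alpha>) v" for v
  proof (cases "v \<in> set c \<union> set d")
    case True
    have "\<exists>i j. i < 2 * n \<and> j < 2 * n \<and> i \<noteq> j \<and> v \<notin> D i \<and> v \<notin> D j"
    proof (cases "v \<in> set c")
      case True
      then obtain i j where "i < length c" "j < length c" "i \<noteq> j"
        "v = c ! i" "v = c ! (Suc j mod length c)"
        by (rule two_cycle_edges_at_vertex[OF cyc(1)])
      then show ?thesis
        using avoid[of i] avoid[of j] n2
        by (intro exI[of _ i] exI[of _ j]) (auto simp: edge_def)
    next
      case False
      then have "v \<in> set d" using True by simp
      then obtain i j where "i < length d" "j < length d" "i \<noteq> j"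
        "v = d ! i" "v = d ! (Suc j mod length d)"
        by (rule two_cycle_edges_at_vertex[OF cyc(2)])
      then show ?thesis
        using avoid[of "length c + i"] avoid[of "length c + j"] n2
        by (intro exI[of _ "length c + i"] exI[of _ "length c + j"]) (auto simp: edge_def)
    qed
    then have "(\<Sum>i<2 * n. of_bool (v \<in> D i)) \<le> 2 * n - 2"
      using card_missing_two[of _ "2 * n" _ v D] by blast
    then show ?thesis using True by (simp add: lookup_\<beta> lookup_\<alpha> lookup_add)
  next
    case False
    have "(\<Sum>i<2 * n. of_bool (v \<in> D i)) \<le> (\<Sum>i<2 * n. 1::nat)"
      by (rule sum_mono) simp
    then show ?thesis using False by (simp add: lookup_\<beta> lookup_\<alpha> lookup_add)
  qed
  have sum_exponents: "\<alpha> + \<alpha> = (\<alpha> + \<alpha> - \<beta>) + \<beta>"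
  proof (rule poly_mapping_eqI)
    show "Poly_Mapping.lookup (\<alpha> + \<alpha>) v = Poly_Mapping.lookup ((\<alpha> + \<alpha> - \<beta>) + \<beta>) v" for v
      using le[of v] by (simp add: lookup_add lookup_minus)
  qed

  define x where "x i = (Poly_Mapping.single (squarefree_exponent (D i)) 1 :: ('v, 'k) mpoly)" for i
  have "x i \<in> ?I" if "i < 2 * n" for i
    unfolding cover_ideal_def x_def prod_variable[symmetric]
    by (rule ideal_generated_base) (use D[OF that] in blast)
  then have "(\<Prod>i<n. x i) \<in> ideal_power ?I n" "(\<Prod>i<n. x (n + i)) \<in> ideal_power ?I n"
    by (auto intro!: prod_mem_ideal_power)
  then have "(\<Prod>i<n. x i) * (\<Prod>i<n. x (n + i)) \<in> ideal_power (ideal_power ?I n) 2"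
    by (rule mult_mem_ideal_power_2)
  moreover have "(\<Prod>i<n. x i) * (\<Prod>i<n. x (n + i)) = (\<Prod>i<2 * n. x i)"
    unfolding mult_2 by (rule prod_lessThan_add[symmetric])
  moreover have "(\<Prod>i<2 * n. x i) = Poly_Mapping.single \<beta> 1"
    unfolding x_def \<beta>_def by (rule prod_single_1)
  ultimately have "Poly_Mapping.single (\<alpha> + \<alpha> - \<beta>) 1 * Poly_Mapping.single \<beta> 1
      \<in> ideal_power (ideal_power ?I n) 2"
    by (intro ideal_power_mult) (simp only:)
  moreover have "z ^ 2 = Poly_Mapping.single (\<alpha> + \<alpha> - \<beta>) 1 * Poly_Mapping.single \<beta> 1"
    using sum_exponents by (simp add: z_def power2_eq_square mult_single)
  ultimately have "z \<in> integral_closure (ideal_power ?I n)"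
    using integral_if_power_mem[of 2 z] by simp
  then have "z \<in> ideal_power ?I n"
    using assms(2) n1 by (auto simp: normal_ideal_def)
  with z_notin show False by blast
qed

end
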